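(* Let $m\ge 2$ and let $p\equiv\pm1\pmod 8$ be an odd prime. Let $\mathcal C$ be a $Z_{2^m}$-quadratic residue $(p,\frac{p+1}{2})$ code, i.e. $\mathcal C=Q_{2^m}$ or $\mathcal C=N_{2^m}$. Then every nonzero vector of $\mathcal C$ of minimum Hamming weight (among nonzero vectors of $\mathcal C$) is odd-like.
   Context: $Z_{2^m}$ is the ring of integers modulo $2^m$ and $R_p=Z_{2^m}[x]/(x^p-1)$; polynomials of degree less than $p$ are identified with their coefficient vectors in $Z_{2^m}^p$. Let $\xi$ be a primitive $p$-th root of unity in an extension field of $GF(2)$, let $Q$ and $N$ be the sets of nonzero quadratic residues and of non-residues modulo $p$, and let $f_{Q_2}(x)=\prod_{i\in Q}(x-\xi^i)$, $f_{N_2}(x)=\prod_{i\in N}(x-\xi^i)$, which are polynomials over $GF(2)$ with $x^p-1=(x-1)f_{Q_2}(x)f_{N_2}(x)$. Let $f_{Q_{2^m}},f_{N_{2^m}}\in Z_{2^m}[x]$ be their Hensel lifts, i.e. the unique monic divisors of $x^p-1$ in $Z_{2^m}[x]$ that reduce modulo $2$ to $f_{Q_2}$, $f_{N_2}$. $Q_{2^m}$ and $N_{2^m}$ are the cyclic codes (ideals of $R_p$) generated by $f_{Q_{2^m}}$ and $f_{N_{2^m}}$ respectively. A vector is even-like if the sum of its coordinates is $0$ modulo $2^m$; otherwise it is odd-like. *)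

theory Defs
  imports
    "HOL-Number_Theory.Number_Theory"
    "Berlekamp_Zassenhaus.Finite_Field"
begin

text \<open>
  The ring of integers modulo \<open>2^m\<close> is the type \<open>'n mod_ring\<close> with \<open>CARD('n) = 2^m\<close>.
  The extension field of \<open>GF(2)\<close> containing the root of unity is an arbitrary field type \<open>'f\<close>
  of characteristic 2; \<open>GF(2)\<close> is its prime subfield \<open>{0, 1}\<close>.
\<close>

definition primitive_root_of_unity :: "nat \<Rightarrow> 'f::field \<Rightarrow> bool" where
  "primitive_root_of_unity p \<xi> \<longleftrightarrow> \<xi> ^ p = 1 \<and> (\<forall>k. 0 < k \<and> k < p \<longrightarrow> \<xi> ^ k \<noteq> 1)"

definition residues_nz :: "nat \<Rightarrow> nat set" where
  "residues_nz p = {i \<in> {1..<p}. QuadRes (int p) (int i)}"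

definition nonresidues :: "nat \<Rightarrow> nat set" where
  "nonresidues p = {i \<in> {1..<p}. \<not> QuadRes (int p) (int i)}"

definition root_poly :: "'f::field \<Rightarrow> nat set \<Rightarrow> 'f poly" where
  "root_poly \<xi> I = (\<Prod>i\<in>I. [:- (\<xi> ^ i), 1:])"

text \<open>
  Reduction modulo 2 of a class modulo \<open>2^m\<close>, viewed in the prime subfield of \<open>'f\<close>.
  It is applied to the canonical representative, and is a ring homomorphism when \<open>'f\<close> has
  characteristic 2 and \<open>CARD('n)\<close> is even.
\<close>

definition reduce2 :: "'n::finite mod_ring \<Rightarrow> 'f::field" where
  "reduce2 a = of_int (to_int_mod_ring a)"

definition xp1 :: "nat \<Rightarrow> 'a::comm_ring_1 poly" where
  "xp1 p = monom 1 p - 1"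

definition hensel_lift :: "nat \<Rightarrow> 'f::field poly \<Rightarrow> 'n::nontriv mod_ring poly" where
  "hensel_lift p f = (THE g. lead_coeff g = 1 \<and> g dvd xp1 p \<and> map_poly reduce2 g = f)"

text \<open>
  Elements of \<open>R_p = Z_{2^m}[x]/(x^p - 1)\<close> are represented by their unique representatives of
  degree less than \<open>p\<close>. The ideal generated by the class of \<open>g\<close> consists of the classes of
  the products \<open>h * g\<close>.
\<close>

definition cyclic_code :: "nat \<Rightarrow> 'a::comm_ring_1 poly \<Rightarrow> 'a poly set" where
  "cyclic_code p g = {c. degree c < p \<and> (\<exists>h. xp1 p dvd c - h * g)}"

definition QR_code :: "nat \<Rightarrow> 'f::field \<Rightarrow> 'n::nontriv mod_ring poly set" where
  "QR_code p \<xi> = cyclic_code p (hensel_lift p (root_poly \<xi> (residues_nz p)))"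

definition NR_code :: "nat \<Rightarrow> 'f::field \<Rightarrow> 'n::nontriv mod_ring poly set" where
  "NR_code p \<xi> = cyclic_code p (hensel_lift p (root_poly \<xi> (nonresidues p)))"

text \<open>The vector of a polynomial \<open>c\<close> of degree less than \<open>p\<close> is \<open>(coeff c 0, \<dots>, coeff c (p - 1))\<close>.\<close>

definition hamming_weight :: "nat \<Rightarrow> 'a::zero poly \<Rightarrow> nat" where
  "hamming_weight p c = card {i. i < p \<and> coeff c i \<noteq> 0}"

definition even_like :: "nat \<Rightarrow> 'a::comm_ring_1 poly \<Rightarrow> bool" where
  "even_like p c \<longleftrightarrow> (\<Sum>i<p. coeff c i) = 0"

abbreviation odd_like :: "nat \<Rightarrow> 'a::comm_ring_1 poly \<Rightarrow> bool" where
  "odd_like p c \<equiv> \<not> even_like p c"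

end

theory Submission
  imports Defs
begin

text \<open>
  The problem reduces to the binary codes, where it follows from the symmetry of the extended
  quadratic residue code under \<open>y \<mapsto> -1/y\<close>.

  Let \<open>g\<close> be the Hensel lift that generates the code. Since \<open>g\<close> is monic, a nonzero codeword can be
  written as \<open>2 ^ k\<close> times a multiple of \<open>g\<close> whose reduction modulo 2 is a nonzero binary codeword \<open>b\<close>,
  and the weight of \<open>b\<close> is at most that of the codeword. Conversely \<open>2 ^ (m - 1)\<close> times a lift of
  a binary codeword is a codeword of the same weight. If the given codeword is even-like,
  then so is \<open>b\<close>; hence it suffices to produce, from an even-like nonzero binary codeword, a nonzero
  binary codeword of smaller weight (lemma \<open>even_like_has_lighter_codeword\<close>).

  For this, pick \<open>j\<^sub>0\<close> with \<open>b\<close> nonzero at \<open>j\<^sub>0\<close> and form the word with coordinate \<open>b (j\<^sub>0 - 1/y)\<close> at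
  \<open>y \<noteq> 0\<close> and coordinate 0 at \<open>y = 0\<close>. It has lost exactly the nonzero coordinate \<open>j\<^sub>0\<close>. That it lies in
  the code is \<open>gleason_prange_shortening\<close>: by Fourier inversion its value at a prescribed zero
  \<open>\<xi> ^ i\<close> is a combination of Kloosterman sums \<open>\<Sum>y. \<xi> ^ (i y + k / y)\<close> in which exactly one of
  \<open>i, k\<close> is a square. In characteristic 2 such a sum vanishes, because \<open>y \<mapsto> k / (i y)\<close> pairs off equal
  terms without fixed points (\<open>kloosterman_sum_char2_eq_0\<close>).

  The condition \<open>p \<equiv> \<plusminus>1 (mod 8)\<close> makes 2 a square modulo \<open>p\<close>, so that the product over the roots
  has coefficients in \<open>GF(2)\<close> and the Hensel lift exists; its uniqueness rests on the separability of
  \<open>x^p - 1\<close> (\<open>root_poly_hensel_ex1\<close>).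
\<close>

section \<open>Quadratic residues\<close>

text \<open>
  By Gauss' lemma the Legendre symbol of 2 is \<open>(-1)\<close> to the number of even integers in
  \<open>(h, 2h]\<close>, where \<open>p = 2h + 1\<close>; this number is even exactly when \<open>p \<equiv> \<plusminus>1 (mod 8)\<close>.
\<close>

lemma QuadRes_two:
  fixes p :: nat
  assumes "prime p" "odd p" and p8: "[int p = 1] (mod 8) \<or> [int p = - 1] (mod 8)"
  shows "QuadRes (int p) 2"
proof -
  have p3: "p > 2"
    using assms prime_ge_2_nat[of p] by (cases "p = 2") auto
  interpret G: GAUSS p 2
    using assms p3 by unfold_locales (auto simp: cong_def)
  define h where "h = (int p - 1) div 2"
  have ph: "int p = 2 * h + 1" using G.p_eq2 h_def by simp
  have E: "G.E = (\<lambda>x. 2 * x) ` {h div 2<..h}"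
  proof -
    have "x * 2 mod int p = 2 * x" if "0 < x" "x \<le> h" for x
      using that ph mod_pos_pos_trivial[of "x * 2" "int p"] by linarith
    hence C: "G.C = (\<lambda>x. 2 * x) ` {0<..h}"
      unfolding G.C_def G.B_def G.A_def h_def[symmetric] image_image by (intro image_cong) auto
    have "G.E = (\<lambda>x. 2 * x) ` {x \<in> {0<..h}. h < 2 * x}"
      unfolding G.E_def h_def[symmetric] C by auto
    also have "{x \<in> {0<..h}. h < 2 * x} = {h div 2<..h}"
    proof -
      have "0 < x \<and> x \<le> h \<and> h < 2 * x \<longleftrightarrow> h div 2 < x \<and> x \<le> h" for x
        using p3 ph by linarith
      thus ?thesis unfolding set_eq_iff mem_Collect_eq greaterThanAtMost_iff by blast
    qed
    finally show ?thesis .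
  qed
  have "card G.E = nat (h - h div 2)"
    unfolding E by (subst card_image) (auto simp: inj_on_def)
  moreover have "even (h - h div 2)"
  proof -
    from p8 have "int p mod 8 = 1 \<or> int p mod 8 = 7" by (auto simp: cong_def)
    hence "h mod 4 = 0 \<or> h mod 4 = 3" unfolding ph by presburger
    thus ?thesis by presburger
  qed
  moreover have "h - h div 2 \<ge> 0" using ph p3 by linarith
  ultimately have "even (card G.E)" by (simp add: even_nat_iff)
  hence "Legendre 2 (int p) = 1" using G.gauss_lemma by simp
  thus ?thesis unfolding Legendre_def by (auto split: if_splits)
qed

text \<open>
  As \<open>p\<close> does not divide \<open>k\<close>, the factor \<open>z\<close> is invertible modulo \<open>p\<close>, and squares can be moved in both
  directions.
\<close>

lemma QuadRes_mult_square_cong: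
  assumes "prime p" "\<not> p dvd k" and cong: "[i * z ^ 2 = k] (mod p)"
  shows "QuadRes (int p) (int i) \<longleftrightarrow> QuadRes (int p) (int k)"
proof
  have cong': "[int i * int z ^ 2 = int k] (mod int p)"
    using cong by (metis cong_int_iff of_nat_mult of_nat_power)
  {
    assume "QuadRes (int p) (int i)"
    then obtain y where "[y ^ 2 = int i] (mod int p)" unfolding QuadRes_def by blast
    hence "[y ^ 2 * int z ^ 2 = int i * int z ^ 2] (mod int p)" by (rule cong_scalar_right)
    hence "[(y * int z) ^ 2 = int k] (mod int p)"
      using cong' unfolding power_mult_distrib by (rule cong_trans)
    thus "QuadRes (int p) (int k)" unfolding QuadRes_def by blast
  }
  assume "QuadRes (int p) (int k)"
  then obtain y where y: "[y ^ 2 = int k] (mod int p)" unfolding QuadRes_def by blast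
  have "\<not> p dvd z"
  proof
    assume "p dvd z"
    hence "p dvd i * z ^ 2" by (simp add: power2_eq_square)
    thus False using cong assms(2) cong_dvd_iff by blast
  qed
  hence "coprime z p" using assms(1) prime_imp_coprime coprime_commute by blast
  then obtain w where w: "[z * w = 1] (mod p)" using cong_solve_coprime_nat by auto
  hence w': "[int z * int w = 1] (mod int p)" by (metis cong_int_iff of_nat_1 of_nat_mult)
  have "[(y * int w) ^ 2 = int k * int w ^ 2] (mod int p)"
    unfolding power_mult_distrib using y by (rule cong_scalar_right)
  also have "[int k * int w ^ 2 = int i * int z ^ 2 * int w ^ 2] (mod int p)"
    using cong' by (intro cong_scalar_right) (rule cong_sym)
  also have "int i * int z ^ 2 * int w ^ 2 = int i * (int z * int w) ^ 2"
    by (simp add: power_mult_distrib)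
  also have "[\<dots> = int i * 1 ^ 2] (mod int p)"
    using w' by (intro cong_scalar_left cong_pow)
  finally show "QuadRes (int p) (int i)" unfolding QuadRes_def by auto
qed

section \<open>Lifting factors along a nilpotent element\<close>

text \<open>
  Over a commutative ring with zero divisors a remainder exists when the divisor is monic, because
  then the scaling factor of pseudo-division is 1.
\<close>

lemma monic_division:
  fixes f g :: "'a::comm_ring_1 poly"
  assumes "lead_coeff g = 1"
  obtains q r where "f = q * g + r" "r = 0 \<or> degree r < degree g"
proof -
  obtain q r where "pseudo_divmod f g = (q, r)" by fastforce
  moreover have "g \<noteq> 0" using assms by auto
  ultimately show ?thesis
    using pseudo_divmod[of g f q r] assms that[of q r] by (auto simp: mult.commute)
qed

lemma ex_smult_factor:
  fixes f :: "'a::comm_ring_1 poly"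
  assumes "\<And>n. c dvd coeff f n"
  shows "\<exists>q. f = smult c q \<and> degree q \<le> degree f"
proof -
  define s where "s a = (if a = 0 then 0 else (SOME b. a = c * b))" for a
  have s0: "s 0 = 0" by (simp add: s_def)
  have s: "c * s a = a" if "c dvd a" for a
    using that someI_ex[of "\<lambda>b. a = c * b"] unfolding s_def dvd_def by (cases "a = 0") auto
  have "f = smult c (map_poly s f)"
    using assms s s0 by (intro poly_eqI) (simp add: coeff_map_poly)
  thus ?thesis using degree_map_poly_le by blast
qed

lemma const_poly_dvd_iff_coeff:
  fixes f :: "'a::comm_ring_1 poly"
  shows "[:c:] dvd f \<longleftrightarrow> (\<forall>n. c dvd coeff f n)"
proof
  assume "[:c:] dvd f"
  then obtain k where "f = [:c:] * k" by (elim dvdE)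
  thus "\<forall>n. c dvd coeff f n" by simp
next
  assume "\<forall>n. c dvd coeff f n"
  then obtain q where "f = [:c:] * q" using ex_smult_factor[of c f] by auto
  thus "[:c:] dvd f" by (rule dvdI)
qed

text \<open>
  Only the factor \<open>g\<close> has to stay monic, so only the correction of \<open>g\<close> is reduced by division with
  remainder; the quotient is absorbed in the cofactor, whose degree is left uncontrolled.
  The Bezout relation modulo \<open>t\<close> is inherited by every later pair, since the pair does not change
  modulo \<open>t\<close>.
\<close>

lemma hensel_factor_exists:
  fixes P g h a b :: "'a::comm_ring_1 poly"
  assumes nil: "t ^ m = 0" and monic: "lead_coeff g = 1"
    and fact: "[:t:] dvd P - g * h" and bez: "[:t:] dvd a * g + b * h - 1"
  shows "\<exists>G. lead_coeff G = 1 \<and> G dvd P \<and> [:t:] dvd G - g"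
proof -
  define T where "T = [:t:]"
  have step: "\<exists>G H. lead_coeff G = 1 \<and> T dvd G - g \<and> T dvd H - h \<and> T ^ Suc k dvd P - G * H" for k
  proof (induction k)
    case 0
    show ?case using monic fact by (intro exI[of _ g] exI[of _ h]) (simp add: T_def)
  next
    case (Suc k)
    then obtain G H where G: "lead_coeff G = 1" "T dvd G - g" and H: "T dvd H - h"
      and "T ^ Suc k dvd P - G * H" by blast
    then obtain e where e: "P - G * H = T ^ Suc k * e" by (elim dvdE)
    obtain q u where u: "e * b = q * G + u" "u = 0 \<or> degree u < degree G"
      using monic_division[OF G(1)] by blast
    \<comment> \<open>chosen so that \<open>G * v + u * H \<equiv> e\<close> modulo \<open>T\<close>, which cancels the error to first order\<close>
    define v where "v = e * a + q * H"
    define G' H' where "G' = G + T ^ Suc k * u" and "H' = H + T ^ Suc k * v"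
    have Tu: "T ^ Suc k * u = smult (t ^ Suc k) u"
      unfolding T_def by (simp add: poly_const_pow flip: power_Suc)
    have "lead_coeff G' = 1"
    proof (cases "u = 0")
      case False
      hence "degree (smult (t ^ Suc k) u) < degree G"
        using u(2) le_less_trans[OF degree_smult_le] by blast
      thus ?thesis unfolding G'_def Tu using G(1)
        using u(2) False by (simp add: degree_add_eq_left coeff_eq_0)
    qed (use G in \<open>simp add: G'_def\<close>)
    moreover have "T dvd G' - g"
    proof -
      have "G' - g = (G - g) + T * (T ^ k * u)" by (simp add: G'_def algebra_simps)
      thus ?thesis using G(2) by (metis dvd_add dvd_triv_left)
    qed
    moreover have "T dvd H' - h"
    proof -
      have "H' - h = (H - h) + T * (T ^ k * v)" by (simp add: H'_def algebra_simps)
      thus ?thesis using H by (metis dvd_add dvd_triv_left)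
    qed
    moreover have "T ^ Suc (Suc k) dvd P - G' * H'"
    proof -
      have "T dvd (a * g + b * h - 1) + a * (G - g) + b * (H - h)"
        using bez G(2) H unfolding T_def by (intro dvd_add dvd_mult)
      also have "(a * g + b * h - 1) + a * (G - g) + b * (H - h) = a * G + b * H - 1"
        by (simp add: algebra_simps)
      finally have "T dvd a * G + b * H - 1" .
      then obtain s where s: "a * G + b * H - 1 = T * s" by (elim dvdE)
      have "P - G' * H' = T ^ Suc k * e - T ^ Suc k * (G * v + u * H) - T ^ Suc k * T ^ Suc k * u * v"
        unfolding G'_def H'_def e[symmetric] by (simp add: algebra_simps)
      also have "G * v + u * H = e * a * G + (q * G + u) * H"
        unfolding v_def by (simp add: algebra_simps)
      also have "\<dots> = e * (T * s) + e"
        unfolding u(1)[symmetric] s[symmetric] by (simp add: algebra_simps)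
      finally have "P - G' * H' = T ^ Suc (Suc k) * (- e * s - T ^ k * u * v)"
        by (simp add: algebra_simps)
      thus ?thesis by simp
    qed
    ultimately show ?case by blast
  qed
  then obtain G H where G: "lead_coeff G = 1" "T dvd G - g" and GH: "T ^ Suc m dvd P - G * H"
    by blast
  \<comment> \<open>the congruence modulo a vanishing power is an equality\<close>
  have "T ^ Suc m = 0" using nil by (simp add: T_def poly_const_pow)
  hence "P = G * H" using GH by simp
  thus ?thesis using G unfolding T_def by (intro exI[of _ G]) simp
qed

lemma one_add_nilpotent_unit:
  fixes x :: "'a::comm_ring_1"
  assumes "x ^ m = 0"
  shows "1 + x dvd 1"
proof -
  have "1 - (- x) ^ m = (1 - (- x)) * (\<Sum>i<m. (- x) ^ i)" by (rule one_diff_power_eq)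
  moreover have "(- x) ^ m = 0" using assms by (simp add: power_minus[of x])
  ultimately show ?thesis by (metis diff_minus_eq_add diff_zero dvdI)
qed

text \<open>
  A monic polynomial keeps its degree modulo a nilpotent element, since such an element never
  divides the leading coefficient 1.
\<close>

lemma degree_eq_if_cong_nilpotent:
  fixes G g :: "'a::comm_ring_1 poly"
  assumes nil: "t ^ m = 0" and "lead_coeff G = 1" "lead_coeff g = 1" and dvd: "[:t:] dvd G - g"
  shows "degree G = degree g"
proof (rule ccontr)
  assume ne: "degree G \<noteq> degree g"
  have "t dvd coeff (G - g) n" for n
    using dvd unfolding const_poly_dvd_iff_coeff by blast
  from this[of "degree G"] this[of "degree g"] have "t dvd 1"
    using ne assms(2,3) by (cases "degree G < degree g") (auto simp: coeff_eq_0)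
  then obtain c where "1 = t * c" by (elim dvdE)
  hence "(1::'a) = (t * c) ^ m" by simp
  thus False using nil by (simp add: power_mult_distrib)
qed

text \<open>
  Coprimality of \<open>G\<^sub>1\<close> and \<open>H\<^sub>2\<close> modulo the nilpotent \<open>t\<close> is coprimality outright, as
  \<open>1 + t * s\<close> is a unit. Since \<open>G\<^sub>1\<close> divides \<open>G\<^sub>2 * H\<^sub>2\<close>, it divides \<open>G\<^sub>2\<close>, which is monic of the same
  degree.
\<close>

lemma hensel_factor_unique:
  fixes G\<^sub>1 G\<^sub>2 a b :: "'a::comm_ring_1 poly"
  assumes nil: "t ^ m = 0" and monic: "lead_coeff G\<^sub>1 = 1" "lead_coeff G\<^sub>2 = 1"
    and cong: "[:t:] dvd G\<^sub>1 - G\<^sub>2" and eq: "G\<^sub>1 * H\<^sub>1 = G\<^sub>2 * H\<^sub>2"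
    and bez: "[:t:] dvd a * G\<^sub>1 + b * H\<^sub>2 - 1"
  shows "G\<^sub>1 = G\<^sub>2"
proof -
  obtain s where s: "a * G\<^sub>1 + b * H\<^sub>2 - 1 = [:t:] * s" using bez by (elim dvdE)
  have "([:t:] * s) ^ m = 0"
    using nil by (simp add: power_mult_distrib poly_const_pow del: mult_pCons_left)
  from one_add_nilpotent_unit[OF this] obtain w where "1 = (a * G\<^sub>1 + b * H\<^sub>2) * w"
    unfolding s[symmetric] by (auto elim: dvdE)
  hence "G\<^sub>2 = (a * G\<^sub>1 + b * H\<^sub>2) * w * G\<^sub>2" by simp
  also have "\<dots> = a * w * G\<^sub>2 * G\<^sub>1 + b * w * (G\<^sub>2 * H\<^sub>2)" by (simp add: algebra_simps)
  also have "\<dots> = G\<^sub>1 * (a * w * G\<^sub>2 + b * w * H\<^sub>1)"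
    unfolding eq[symmetric] by (simp add: algebra_simps)
  finally obtain v where v: "G\<^sub>2 = G\<^sub>1 * v" by blast
  have "v \<noteq> 0" using monic(2) v by auto
  hence "degree G\<^sub>2 = degree G\<^sub>1 + degree v" "lead_coeff v = 1"
    using degree_monic_mult[OF monic(1), of v] lcoeff_monic_mult[OF monic(1), of v] v monic(2) by auto
  hence "v = 1"
    using degree_eq_if_cong_nilpotent[OF nil monic cong] monic_degree_0[of v] by simp
  thus ?thesis using v by simp
qed

section \<open>Kloosterman sums and the symmetry of binary residue codes\<close>

text \<open>
  The two members of each orbit contribute equal terms, and these cancel.
\<close>

lemma sum_fixpoint_free_involution_char2:
  fixes f :: "nat \<Rightarrow> 'a::comm_ring_1"
  assumes "(2::'a) = 0" "finite A"
    and inv: "\<And>x. x \<in> A \<Longrightarrow> \<tau> x \<in> A" "\<And>x. x \<in> A \<Longrightarrow> \<tau> (\<tau> x) = x" "\<And>x. x \<in> A \<Longrightarrow> \<tau> x \<noteq> x"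
    and f: "\<And>x. x \<in> A \<Longrightarrow> f (\<tau> x) = f x"
  shows "(\<Sum>x\<in>A. f x) = 0"
proof -
  define L U where "L = {x \<in> A. x < \<tau> x}" and "U = {x \<in> A. \<tau> x < x}"
  have "A = L \<union> U" "L \<inter> U = {}" "finite L" "finite U"
    using inv(3) assms(2) unfolding L_def U_def by (auto simp: neq_iff)
  hence "sum f A = sum f L + sum f U" by (metis sum.union_disjoint)
  also have "sum f U = sum f L"
    by (rule sum.reindex_bij_witness[of _ \<tau> \<tau>]) (use inv f in \<open>auto simp: L_def U_def\<close>)
  also have "sum f L + sum f L = 2 * sum f L" by simp
  finally show ?thesis using assms(1) by simp
qed

lemma power_cong_of_root_of_unity:
  fixes \<xi> :: "'a::comm_ring_1"
  assumes "\<xi> ^ p = 1" "[a = b] (mod p)"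
  shows "\<xi> ^ a = \<xi> ^ b"
proof -
  have "\<xi> ^ n = \<xi> ^ (n mod p)" for n
  proof -
    have "\<xi> ^ n = \<xi> ^ (p * (n div p) + n mod p)" by simp
    also have "\<dots> = \<xi> ^ (n mod p)" unfolding power_add power_mult assms(1) by simp
    finally show ?thesis .
  qed
  thus ?thesis using assms(2) unfolding cong_def by metis
qed

lemma power_eq_one_iff_of_prime_order:
  fixes \<xi> :: "'a::comm_ring_1"
  assumes "prime p" "\<xi> ^ p = 1" "\<xi> \<noteq> 1"
  shows "\<xi> ^ n = 1 \<longleftrightarrow> p dvd n"
proof
  assume n: "\<xi> ^ n = 1"
  show "p dvd n"
  proof (rule ccontr)
    assume "\<not> p dvd n"
    hence "coprime n p" using assms(1) prime_imp_coprime coprime_commute by blast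
    then obtain x where "[n * x = 1] (mod p)" using cong_solve_coprime_nat by auto
    hence "\<xi> ^ (n * x) = \<xi> ^ 1" by (rule power_cong_of_root_of_unity[OF assms(2)])
    thus False using n assms(3) by (simp add: power_mult)
  qed
qed (use assms(2) in \<open>auto simp: power_mult\<close>)

lemma sum_powers_root_of_unity:
  fixes \<xi> :: "'a::field"
  assumes "prime p" "\<xi> ^ p = 1" "\<xi> \<noteq> 1"
  shows "(\<Sum>k<p. \<xi> ^ (n * k)) = (if p dvd n then of_nat p else 0)"
proof (cases "p dvd n")
  case True
  hence "\<xi> ^ (n * k) = 1" for k
    using power_eq_one_iff_of_prime_order[OF assms, of "n * k"] by simp
  thus ?thesis using True by simp
next
  case False
  hence "\<xi> ^ n \<noteq> 1" using power_eq_one_iff_of_prime_order[OF assms, of n] by simp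
  moreover have "(\<xi> ^ n) ^ p = 1" using assms(2) by (metis power_commutes power_mult power_one mult.commute)
  ultimately show ?thesis using False by (simp add: power_mult geometric_sum)
qed

text \<open>
  With \<open>v y\<close> in the role of \<open>1/y\<close>, this is the Kloosterman sum over \<open>\<xi> ^ (i y + k / y)\<close>. The
  substitution \<open>y \<mapsto> k / (i y)\<close> is an involution that exchanges the two summands in the exponent. It
  fixes \<open>y\<close> only if \<open>i y^2 = k\<close>, so it has no fixed point when \<open>i k\<close> is not a square.
\<close>

lemma kloosterman_sum_char2_eq_0:
  fixes \<xi> :: "'a::field" and v :: "nat \<Rightarrow> nat"
  assumes char2: "(2::'a) = 0" and "prime p" "\<xi> ^ p = 1"
    and v: "\<And>y. y \<in> {1..<p} \<Longrightarrow> v y \<in> {1..<p} \<and> [y * v y = 1] (mod p)"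
    and ik: "i \<in> {1..<p}" "k \<in> {1..<p}" and nonres: "\<And>z::nat. \<not> [i * z ^ 2 = k] (mod p)"
  shows "(\<Sum>y\<in>{1..<p}. \<xi> ^ (i * y + k * v y)) = 0"
proof -
  have nd: "\<not> p dvd y" if "y \<in> {1..<p}" for y
    using that nat_dvd_not_less by auto
  define \<tau> where "\<tau> y = (v i * k * v y) mod p" for y
  have \<tau>: "\<tau> y \<in> {1..<p}" if "y \<in> {1..<p}" for y
  proof -
    have "\<not> p dvd v i * k * v y"
      using nd v[OF that] v[OF ik(1)] ik(2) assms(2) by (simp add: prime_dvd_mult_iff)
    thus ?thesis unfolding \<tau>_def using assms(2)
      by (auto simp: dvd_eq_mod_eq_0 prime_gt_0_nat)
  qed
  have i\<tau>: "[i * \<tau> y = k * v y] (mod p)" for y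
  proof -
    have "[i * \<tau> y = i * (v i * k * v y)] (mod p)"
      unfolding \<tau>_def by (intro cong_scalar_left) simp
    also have "i * (v i * k * v y) = (i * v i) * (k * v y)" by simp
    also have "[\<dots> = 1 * (k * v y)] (mod p)"
      using v[OF ik(1)] by (intro cong_scalar_right) simp
    finally show ?thesis by simp
  qed
  have i\<tau>y: "[i * \<tau> y * y = k] (mod p)" if "y \<in> {1..<p}" for y
  proof -
    have "[i * \<tau> y * y = k * v y * y] (mod p)"
      using i\<tau> by (rule cong_scalar_right)
    also have "k * v y * y = k * (y * v y)" by simp
    also have "[\<dots> = k * 1] (mod p)" using v[OF that] by (intro cong_scalar_left) simp
    finally show ?thesis by simp
  qed
  have kv\<tau>: "[k * v (\<tau> y) = i * y] (mod p)" if "y \<in> {1..<p}" for y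
  proof -
    have "[k * v (\<tau> y) = i * \<tau> y * y * v (\<tau> y)] (mod p)"
      using i\<tau>y[OF that] by (intro cong_scalar_right) (rule cong_sym)
    also have "i * \<tau> y * y * v (\<tau> y) = i * y * (\<tau> y * v (\<tau> y))" by simp
    also have "[\<dots> = i * y * 1] (mod p)" using v[OF \<tau>[OF that]] by (intro cong_scalar_left) simp
    finally show ?thesis by simp
  qed
  show ?thesis
  proof (rule sum_fixpoint_free_involution_char2[OF char2, where \<tau> = \<tau>])
    fix y assume y: "y \<in> {1..<p}"
    show "\<tau> y \<in> {1..<p}" using \<tau>[OF y] .
    have "[i * \<tau> (\<tau> y) = i * y] (mod p)" using i\<tau> kv\<tau>[OF y] by (rule cong_trans)
    moreover have "coprime i p"
      using nd[OF ik(1)] assms(2) prime_imp_coprime coprime_commute by blast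
    ultimately have "[\<tau> (\<tau> y) = y] (mod p)" using cong_mult_lcancel_nat by blast
    thus "\<tau> (\<tau> y) = y"
      using \<tau>[OF \<tau>[OF y]] y by (auto intro: cong_less_modulus_unique_nat)
    show "\<tau> y \<noteq> y" using i\<tau>y[OF y] nonres[of y] by (auto simp: power2_eq_square mult.assoc)
    have "[i * \<tau> y + k * v (\<tau> y) = k * v y + i * y] (mod p)"
      using i\<tau> kv\<tau>[OF y] by (rule cong_add)
    thus "\<xi> ^ (i * \<tau> y + k * v (\<tau> y)) = \<xi> ^ (i * y + k * v y)"
      using power_cong_of_root_of_unity[OF assms(3)] by (metis add.commute)
  qed simp
qed

lemma inverse_mod_prime:
  assumes "prime (p::nat)" "y \<in> {1..<p}"
  shows "y ^ (p - 2) mod p \<in> {1..<p} \<and> [y * (y ^ (p - 2) mod p) = 1] (mod p)"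
proof -
  have nd: "\<not> p dvd y" using assms(2) nat_dvd_not_less by auto
  hence ndp: "\<not> p dvd y ^ (p - 2)" using assms(1) prime_dvd_power_nat by blast
  have "[y * (y ^ (p - 2) mod p) = y * y ^ (p - 2)] (mod p)"
    by (intro cong_scalar_left) simp
  moreover have "Suc (p - 2) = p - 1" using prime_ge_2_nat[OF assms(1)] by linarith
  hence "y * y ^ (p - 2) = y ^ (p - 1)" by (metis power_Suc)
  ultimately have "[y * (y ^ (p - 2) mod p) = 1] (mod p)"
    using fermat_theorem[OF assms(1) nd] by (metis cong_trans)
  moreover have "y ^ (p - 2) mod p < p" using assms(2) by simp
  moreover have "y ^ (p - 2) mod p \<noteq> 0" using ndp by (simp add: dvd_eq_mod_eq_0)
  ultimately show ?thesis by simp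
qed

text \<open>
  Extend every word by a coordinate at infinity that completes its coordinate sum to 0. The extended
  code is invariant under the map \<open>y \<mapsto> j\<^sub>0 - 1/y\<close> of the projective line, and \<open>\<pi>\<close> is this map away from 0
  and infinity. It moves coordinate \<open>j\<^sub>0\<close> to infinity and the coordinate at infinity, here 0, to position 0.

  Fourier inversion expresses \<open>\<beta>\<close> through its values at \<open>\<xi> ^ k\<close>, of which only those with \<open>k\<close>
  outside \<open>I\<close> and nonzero survive. Evaluating the rearranged word at \<open>\<xi> ^ i\<close> turns each of them into a
  multiple of a Kloosterman sum with parameters \<open>i\<close> and \<open>k\<close>, and this sum vanishes.
\<close>

lemma gleason_prange_shortening:
  fixes \<xi> :: "'a::field" and \<beta> :: "nat \<Rightarrow> 'a"
  assumes char2: "(2::'a) = 0" and "prime p" "odd p" "\<xi> ^ p = 1" "\<xi> \<noteq> 1"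
    and I: "I \<subseteq> {1..<p}"
    and nonres: "\<And>i k z. i \<in> I \<Longrightarrow> k \<in> {1..<p} - I \<Longrightarrow> \<not> [i * z ^ 2 = k] (mod p)"
    and even: "(\<Sum>j<p. \<beta> j) = 0"
    and zeros: "\<And>i. i \<in> I \<Longrightarrow> (\<Sum>j<p. \<beta> j * \<xi> ^ (i * j)) = 0"
    and j0: "j\<^sub>0 < p"
  shows "\<exists>\<pi>. bij_betw \<pi> {1..<p} ({..<p} - {j\<^sub>0}) \<and>
             (\<forall>i\<in>I. (\<Sum>y\<in>{1..<p}. \<beta> (\<pi> y) * \<xi> ^ (i * y)) = 0)"
proof -
  note pow_cong = power_cong_of_root_of_unity[OF \<open>\<xi> ^ p = 1\<close>]
  have p0: "p > 0" using j0 by simp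
  define v where "v y = y ^ (p - 2) mod p" for y
  have v: "v y \<in> {1..<p} \<and> [y * v y = 1] (mod p)" if "y \<in> {1..<p}" for y
    unfolding v_def by (rule inverse_mod_prime[OF assms(2) that])
  define \<pi> where "\<pi> y = (j\<^sub>0 + (p - v y)) mod p" for y
  have \<pi>: "[\<pi> y + v y = j\<^sub>0] (mod p)" if "y \<in> {1..<p}" for y
  proof -
    have "[\<pi> y + v y = j\<^sub>0 + (p - v y) + v y] (mod p)"
      unfolding \<pi>_def by (intro cong_add_rcancel_nat[THEN iffD2]) simp
    also have "j\<^sub>0 + (p - v y) + v y = j\<^sub>0 + p" using v[OF that] by auto
    also have "[j\<^sub>0 + p = j\<^sub>0] (mod p)" by (simp add: cong_def)
    finally show ?thesis .
  qed
  have bij: "bij_betw \<pi> {1..<p} ({..<p} - {j\<^sub>0})"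
  proof -
    have inj: "inj_on \<pi> {1..<p}"
    proof
      fix x y assume x: "x \<in> {1..<p}" and y: "y \<in> {1..<p}" and "\<pi> x = \<pi> y"
      hence "[\<pi> x + v x = \<pi> x + v y] (mod p)"
        using \<pi>[OF x] \<pi>[OF y] by (metis cong_sym cong_trans)
      hence "[v x = v y] (mod p)" by (simp add: cong_add_lcancel_nat)
      hence eq: "v x = v y"
        using v[OF x] v[OF y] by (auto intro: cong_less_modulus_unique_nat)
      have "[x * v x * y = 1 * y] (mod p)" using v[OF x] by (intro cong_scalar_right) simp
      moreover have "[y * v y * x = 1 * x] (mod p)" using v[OF y] by (intro cong_scalar_right) simp
      moreover have "x * v x * y = y * v y * x" using eq by simp
      ultimately have "[x = y] (mod p)" by (metis cong_sym cong_trans mult_1)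
      thus "x = y" using x y by (auto intro: cong_less_modulus_unique_nat)
    qed
    have "\<pi> y \<noteq> j\<^sub>0" if y: "y \<in> {1..<p}" for y
    proof
      assume "\<pi> y = j\<^sub>0"
      hence "[j\<^sub>0 + v y = j\<^sub>0 + 0] (mod p)" using \<pi>[OF y] by simp
      hence "[v y = 0] (mod p)" by (simp only: cong_add_lcancel_nat)
      thus False using v[OF y] by (auto simp: cong_def)
    qed
    moreover have "\<pi> y < p" for y using p0 by (simp add: \<pi>_def)
    ultimately have sub: "\<pi> ` {1..<p} \<subseteq> {..<p} - {j\<^sub>0}" by blast
    have "card ({..<p} - {j\<^sub>0}) = card (\<pi> ` {1..<p})"
      unfolding card_image[OF inj] using j0 by simp
    hence "\<pi> ` {1..<p} = {..<p} - {j\<^sub>0}" using sub by (intro card_subset_eq) auto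
    thus ?thesis using inj by (simp add: bij_betw_def)
  qed
  \<comment> \<open>the values of the word at the \<open>p\<close>-th roots of unity\<close>
  define B where "B k = (\<Sum>j<p. \<beta> j * \<xi> ^ (k * j))" for k
  have of_nat_p: "of_nat p = (1::'a)"
    using \<open>odd p\<close> char2 by (auto elim!: oddE)
  have fourier: "\<beta> z = (\<Sum>k\<in>{1..<p} - I. B k * \<xi> ^ (k * (p - z)))" if z: "z < p" for z
  proof -
    have "(\<Sum>k<p. B k * \<xi> ^ (k * (p - z))) = (\<Sum>k<p. \<Sum>j<p. \<beta> j * \<xi> ^ ((j + (p - z)) * k))"
      unfolding B_def sum_distrib_right
      by (intro sum.cong refl) (simp add: power_add algebra_simps)
    also have "\<dots> = (\<Sum>j<p. \<beta> j * (\<Sum>k<p. \<xi> ^ ((j + (p - z)) * k)))"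
      by (subst sum.swap) (simp add: sum_distrib_left)
    also have "\<dots> = (\<Sum>j<p. if j = z then \<beta> j else 0)"
    proof (intro sum.cong refl)
      fix j assume j: "j \<in> {..<p}"
      have "p dvd j + (p - z) \<longleftrightarrow> [j + (p - z) = z + (p - z)] (mod p)"
        using z by (simp add: cong_def dvd_eq_mod_eq_0)
      also have "\<dots> \<longleftrightarrow> j = z"
        using j z cong_less_modulus_unique_nat[of j z p] unfolding cong_add_rcancel_nat by auto
      finally show "\<beta> j * (\<Sum>k<p. \<xi> ^ ((j + (p - z)) * k)) = (if j = z then \<beta> j else 0)"
        using sum_powers_root_of_unity[OF assms(2,4,5), of "j + (p - z)"] of_nat_p by simp
    qed
    also have "\<dots> = \<beta> z" using z by simp
    finally have "\<beta> z = (\<Sum>k<p. B k * \<xi> ^ (k * (p - z)))" by simp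
    also have "\<dots> = (\<Sum>k\<in>{1..<p} - I. B k * \<xi> ^ (k * (p - z)))"
    proof (intro sum.mono_neutral_right ballI)
      fix k assume k: "k \<in> {..<p} - ({1..<p} - I)"
      hence "k = 0 \<or> k \<in> I" by auto
      hence "B k = 0" using even zeros unfolding B_def by auto
      thus "B k * \<xi> ^ (k * (p - z)) = 0" by simp
    qed auto
    finally show ?thesis .
  qed
  have "(\<Sum>y\<in>{1..<p}. \<beta> (\<pi> y) * \<xi> ^ (i * y)) = 0" if i: "i \<in> I" for i
  proof -
    have "(\<Sum>y\<in>{1..<p}. \<beta> (\<pi> y) * \<xi> ^ (i * y))
        = (\<Sum>y\<in>{1..<p}. \<Sum>k\<in>{1..<p} - I. B k * \<xi> ^ (k * (p - j\<^sub>0)) * \<xi> ^ (i * y + k * v y))"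
    proof (intro sum.cong refl)
      fix y assume y: "y \<in> {1..<p}"
      have \<pi>lt: "\<pi> y < p" using p0 by (simp add: \<pi>_def)
      \<comment> \<open>\<open>-\<pi> y = -j\<^sub>0 + 1/y\<close>, written without negative exponents\<close>
      have neg: "[p - \<pi> y = (p - j\<^sub>0) + v y] (mod p)"
      proof -
        have "[\<pi> y + v y + (p - j\<^sub>0) = j\<^sub>0 + (p - j\<^sub>0)] (mod p)"
          using \<pi>[OF y] by (simp only: cong_add_rcancel_nat)
        hence "[\<pi> y + ((p - j\<^sub>0) + v y) = \<pi> y + (p - \<pi> y)] (mod p)"
          using j0 \<pi>lt by (simp add: ac_simps)
        thus ?thesis by (simp only: cong_add_lcancel_nat cong_sym_eq)
      qed
      have "\<xi> ^ (k * (p - \<pi> y)) = \<xi> ^ (k * (p - j\<^sub>0)) * \<xi> ^ (k * v y)" for k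
        using pow_cong[OF cong_scalar_left[OF neg, of k]]
        by (simp add: power_add distrib_left)
      thus "\<beta> (\<pi> y) * \<xi> ^ (i * y)
          = (\<Sum>k\<in>{1..<p} - I. B k * \<xi> ^ (k * (p - j\<^sub>0)) * \<xi> ^ (i * y + k * v y))"
        unfolding fourier[OF \<pi>lt] sum_distrib_right by (simp add: power_add ac_simps)
    qed
    also have "\<dots> = (\<Sum>k\<in>{1..<p} - I. B k * \<xi> ^ (k * (p - j\<^sub>0)) *
        (\<Sum>y\<in>{1..<p}. \<xi> ^ (i * y + k * v y)))"
      by (subst sum.swap) (simp add: sum_distrib_left)
    also have "\<dots> = 0"
      using kloosterman_sum_char2_eq_0[OF char2 assms(2,4) v] nonres i I
      by (intro sum.neutral) (auto simp: subset_iff)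
    finally show ?thesis .
  qed
  thus ?thesis using bij by blast
qed

section \<open>The product over a set of roots of unity\<close>

lemma degree_root_poly: "finite I \<Longrightarrow> degree (root_poly \<xi> I) = card I"
  unfolding root_poly_def by (subst degree_prod_eq_sum_degree) auto

lemma monic_root_poly: "lead_coeff (root_poly \<xi> I) = 1"
  unfolding root_poly_def by (simp add: lead_coeff_prod)

lemma poly_root_poly_eq_0_iff:
  "finite I \<Longrightarrow> poly (root_poly \<xi> I) x = 0 \<longleftrightarrow> (\<exists>i\<in>I. x = \<xi> ^ i)"
  unfolding root_poly_def by (auto simp: poly_prod)

lemma inj_on_powers_of_prime_order:
  fixes \<xi> :: "'a::field"
  assumes "prime p" "\<xi> ^ p = 1" "\<xi> \<noteq> 1"
  shows "inj_on (\<lambda>i. \<xi> ^ i) {..<p}"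
proof -
  have "\<xi> \<noteq> 0" using assms by (auto simp: power_0_left split: if_splits)
  have "i = j" if "\<xi> ^ i = \<xi> ^ j" "i \<le> j" "j < p" for i j
  proof -
    have "\<xi> ^ j = \<xi> ^ i * \<xi> ^ (j - i)" using that(2) by (simp flip: power_add)
    hence "\<xi> ^ (j - i) = 1" using that(1) \<open>\<xi> \<noteq> 0\<close> by simp
    hence "p dvd j - i" using power_eq_one_iff_of_prime_order[OF assms] by blast
    thus ?thesis using that(2,3) nat_dvd_not_less[of "j - i" p] by linarith
  qed
  thus ?thesis by (intro inj_onI) (metis lessThan_iff nat_le_linear)
qed

text \<open>
  The powers \<open>\<xi> ^ i\<close> with \<open>i < p\<close> are distinct, so these zeros exceed the degree in number.
\<close>

lemma poly_eq_0_if_vanishes_on_powers: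
  fixes r :: "'a::field poly"
  assumes "prime p" "\<xi> ^ p = 1" "\<xi> \<noteq> 1" "I \<subseteq> {..<p}"
    and "\<And>i. i \<in> I \<Longrightarrow> poly r (\<xi> ^ i) = 0" and "degree r < card I"
  shows "r = 0"
proof (rule ccontr)
  assume "r \<noteq> 0"
  have "card I = card ((\<lambda>i. \<xi> ^ i) ` I)"
    using inj_on_subset[OF inj_on_powers_of_prime_order[OF assms(1-3)] assms(4)]
    by (simp add: card_image)
  also have "\<dots> \<le> card {x. poly r x = 0}"
    using assms(5) \<open>r \<noteq> 0\<close> by (intro card_mono poly_roots_finite) auto
  also have "\<dots> \<le> degree r" using \<open>r \<noteq> 0\<close> by (rule card_poly_roots_bound)
  finally show False using assms(6) by simp
qed

lemma xp1_eq_root_poly: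
  fixes \<xi> :: "'a::field"
  assumes "prime p" "\<xi> ^ p = 1" "\<xi> \<noteq> 1"
  shows "xp1 p = root_poly \<xi> {..<p}"
proof -
  have p: "p > 0" using assms(1) prime_gt_0_nat by simp
  define r where "r = xp1 p - root_poly \<xi> {..<p}"
  have "degree r < p"
  proof -
    have "degree (xp1 p :: 'a poly) \<le> p" unfolding xp1_def
      using degree_diff_le[of "monom (1::'a) p" p 1] by (simp add: degree_monom_le)
    hence "degree r \<le> p" unfolding r_def
      by (intro degree_diff_le) (simp_all add: degree_root_poly)
    moreover have "coeff r p = 0"
      using p monic_root_poly[of \<xi> "{..<p}"] by (simp add: r_def xp1_def degree_root_poly)
    ultimately show ?thesis using p
      by (metis coeff_0_degree_minus_1 degree_0 diff_less le_neq_implies_less less_one eq_zero_or_degree_less)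
  qed
  moreover have "poly r (\<xi> ^ i) = 0" if "i < p" for i
  proof -
    have "(\<xi> ^ i) ^ p = 1" using assms(2) by (metis mult.commute power_mult power_one)
    moreover have "poly (root_poly \<xi> {..<p}) (\<xi> ^ i) = 0"
      using that by (subst poly_root_poly_eq_0_iff) auto
    ultimately show ?thesis by (simp add: r_def xp1_def poly_monom)
  qed
  ultimately have "r = 0"
    using poly_eq_0_if_vanishes_on_powers[OF assms, of "{..<p}" r] by simp
  thus ?thesis by (simp add: r_def)
qed

lemma inj_on_double_mod:
  fixes p :: nat
  assumes "odd p"
  shows "inj_on (\<lambda>i. 2 * i mod p) {..<p}"
proof
  fix i j assume ij: "i \<in> {..<p}" "j \<in> {..<p}" "2 * i mod p = 2 * j mod p"
  have "coprime 2 p" using assms by simp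
  moreover have "[2 * i = 2 * j] (mod p)" using ij(3) unfolding cong_def .
  ultimately have "[i = j] (mod p)" using cong_mult_lcancel_nat by blast
  thus "i = j" using ij by (auto intro: cong_less_modulus_unique_nat)
qed

text \<open>
  Squaring all coefficients replaces the roots \<open>\<xi> ^ i\<close> by \<open>\<xi> ^ (2 i)\<close>, which permutes them. So every
  coefficient is a root of \<open>x^2 - x\<close>.
\<close>

lemma root_poly_coeffs_binary:
  fixes \<xi> :: "'a::field"
  assumes char2: "(2::'a) = 0" and "odd p" "\<xi> ^ p = 1" and I: "I \<subseteq> {..<p}"
    and dbl: "\<And>i. i \<in> I \<Longrightarrow> 2 * i mod p \<in> I"
  shows "coeff (root_poly \<xi> I) n \<in> {0, 1}"
proof -
  have double: "x + x = 0" for x :: 'a using char2 by (metis mult_2 mult_zero_left)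
  interpret sq: comm_ring_hom "\<lambda>x::'a. x ^ 2"
  proof
    show "(x + y) ^ 2 = x ^ 2 + y ^ 2" for x y :: 'a
      using char2 by (simp add: power2_sum)
    show "(x * y) ^ 2 = x ^ 2 * y ^ 2" for x y :: 'a by (simp add: power_mult_distrib)
  qed auto
  interpret sqp: map_poly_comm_ring_hom "\<lambda>x::'a. x ^ 2" ..
  have fin: "finite I" using I finite_subset by blast
  have inj: "inj_on (\<lambda>i. 2 * i mod p) I"
    using inj_on_double_mod[OF assms(2)] I by (rule inj_on_subset)
  have surj: "(\<lambda>i. 2 * i mod p) ` I = I"
    using dbl by (intro endo_inj_surj fin inj) auto
  have "map_poly (\<lambda>x. x ^ 2) (root_poly \<xi> I) = (\<Prod>i\<in>I. [:- (\<xi> ^ (2 * i mod p)), 1:])"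
    unfolding root_poly_def sqp.hom_prod
  proof (intro prod.cong refl)
    fix i
    have "\<xi> ^ (2 * i mod p) = (\<xi> ^ i) ^ 2"
      using power_cong_of_root_of_unity[OF assms(3), of "2 * i mod p" "2 * i"]
      by (simp add: power_mult mult.commute[of 2])
    moreover have "(- (\<xi> ^ i)) ^ 2 = - ((\<xi> ^ i) ^ 2)"
      using double[of "(\<xi> ^ i) ^ 2"] by (simp add: eq_neg_iff_add_eq_0)
    ultimately show "map_poly (\<lambda>x. x ^ 2) [:- (\<xi> ^ i), 1:] = [:- (\<xi> ^ (2 * i mod p)), 1:]"
      by (simp add: map_poly_pCons)
  qed
  also have "\<dots> = root_poly \<xi> I"
    unfolding root_poly_def using prod.reindex[OF inj, of "\<lambda>i. [:- (\<xi> ^ i), 1:]"] surj by simp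
  finally have "coeff (root_poly \<xi> I) n ^ 2 = coeff (root_poly \<xi> I) n"
    by (metis (no_types) sq.coeff_map_poly_hom)
  hence "coeff (root_poly \<xi> I) n * (coeff (root_poly \<xi> I) n - 1) = 0"
    by (simp add: power2_eq_square algebra_simps)
  thus ?thesis by auto
qed

lemma root_poly_mult_complement:
  assumes "finite J" "I \<subseteq> J"
  shows "root_poly \<xi> J = root_poly \<xi> I * root_poly \<xi> (J - I)"
  unfolding root_poly_def using assms by (metis mult.commute prod.subset_diff)

lemma complement_doubling:
  fixes p :: nat
  assumes "odd p" "I \<subseteq> {..<p}" and dbl: "\<And>i. i \<in> I \<Longrightarrow> 2 * i mod p \<in> I"
    and j: "j \<in> {..<p} - I"
  shows "2 * j mod p \<in> {..<p} - I"
proof -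
  note inj = inj_on_double_mod[OF assms(1)]
  have surj: "(\<lambda>i. 2 * i mod p) ` I = I"
    using dbl assms(2) finite_subset[OF assms(2)] inj_on_subset[OF inj assms(2)]
    by (intro endo_inj_surj) auto
  have "2 * j mod p \<notin> I"
  proof
    assume "2 * j mod p \<in> I"
    then obtain i where i: "i \<in> I" "2 * j mod p = 2 * i mod p" using surj by blast
    hence "j = i" using inj_onD[OF inj i(2)] j assms(2) by blast
    thus False using i j by simp
  qed
  moreover have "2 * j mod p < p" using j by auto
  ultimately show ?thesis by simp
qed

section \<open>Reduction modulo 2 and the Hensel lift\<close>

text \<open>
  The properties of reduction on the integers modulo \<open>2^m\<close> that the argument uses: \<open>'r\<close> is a local
  ring whose maximal ideal is generated by the nilpotent element 2, with residue field
  \<open>{0, 1} \<subseteq> 'f\<close>.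
\<close>

locale binary_reduction = comm_ring_hom red
  for red :: "'r::comm_ring_1 \<Rightarrow> 'f::field" +
  fixes m :: nat
  assumes two_power_m: "(2::'r) ^ m = 0"
    and two_power_nonzero: "k < m \<Longrightarrow> (2::'r) ^ k \<noteq> 0"
    and red_eq_0_iff: "red a = 0 \<longleftrightarrow> 2 dvd a"
    and red_binary: "red a \<in> {0, 1}"
begin

sublocale red_poly: map_poly_comm_ring_hom red ..

lemma char_two: "(2::'f) = 0"
  using red_eq_0_iff[of 2] by (simp add: hom_numeral)

lemma map_poly_red_eq_0_iff: "map_poly red f = 0 \<longleftrightarrow> [:2:] dvd f"
  unfolding const_poly_dvd_iff_coeff by (simp add: poly_eq_iff red_eq_0_iff)

lemma map_poly_red_eq_iff: "map_poly red f = map_poly red g \<longleftrightarrow> [:2:] dvd f - g"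
  using map_poly_red_eq_0_iff[of "f - g"] by (simp add: red_poly.hom_minus)

text \<open>
  An element with nonzero reduction has the form \<open>1 + 2 z\<close> and is therefore a unit.
\<close>

lemma two_power_mult_nonzero:
  assumes "k < m" "red a \<noteq> 0"
  shows "2 ^ k * a \<noteq> 0"
proof
  assume "2 ^ k * a = 0"
  have "red (a - 1) = 0" using assms(2) red_binary[of a] by (simp add: hom_minus)
  then obtain z where "a = 1 + 2 * z" by (auto simp: red_eq_0_iff elim!: dvdE) (metis add.commute diff_add_cancel)
  moreover have "(2 * z) ^ m = 0" by (simp add: power_mult_distrib two_power_m)
  note one_add_nilpotent_unit[OF this]
  ultimately obtain w where "1 = a * w" by (auto elim: dvdE)
  hence "2 ^ k = 2 ^ k * a * w" by (metis mult.assoc mult.right_neutral)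
  thus False using \<open>2 ^ k * a = 0\<close> two_power_nonzero[OF assms(1)] by simp
qed

definition lift_bit :: "'f \<Rightarrow> 'r" where
  "lift_bit x = (if x = 0 then 0 else 1)"

lemma red_lift_bit: "x \<in> {0, 1} \<Longrightarrow> red (lift_bit x) = x"
  by (auto simp: lift_bit_def)

lemma map_poly_red_lift:
  assumes "\<And>n. coeff f n \<in> {0, 1}"
  shows "map_poly red (map_poly lift_bit f) = f"
proof -
  have "lift_bit 0 = 0" by (simp add: lift_bit_def)
  thus ?thesis using red_lift_bit[OF assms] by (intro poly_eqI) (simp add: coeff_map_poly)
qed

text \<open>
  The bound on the degree of the quotient is not automatic, because multiplication by \<open>2 ^ k\<close> may
  kill a leading coefficient; it keeps the divided codeword of length \<open>p\<close>.
\<close>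

lemma ex_two_power_factor:
  assumes "q \<noteq> 0"
  shows "\<exists>k q'. k < m \<and> q = smult (2 ^ k) q' \<and> map_poly red q' \<noteq> 0 \<and> degree q' \<le> degree q"
proof -
  define K where "K = {k. \<forall>n. 2 ^ k dvd coeff q n}"
  have bound: "k < m" if "k \<in> K" for k
  proof (rule ccontr)
    assume "\<not> k < m"
    hence "(2::'r) ^ k = 0" using two_power_m by (metis le_add_diff_inverse mult_zero_left not_less power_add)
    thus False using that assms by (auto simp: K_def poly_eq_iff)
  qed
  have "0 \<in> K" by (simp add: K_def)
  hence "K \<noteq> {}" by blast
  have "finite K" using bound by (auto intro: finite_subset[of _ "{..<m}"])
  define k where "k = Max K"
  have k: "k \<in> K" "Suc k \<notin> K"
    using Max_in[OF \<open>finite K\<close> \<open>K \<noteq> {}\<close>] Max_ge[OF \<open>finite K\<close>, of "Suc k"]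
    unfolding k_def by auto
  obtain q' where q': "q = smult (2 ^ k) q'" "degree q' \<le> degree q"
    using ex_smult_factor[of "2 ^ k" q] k(1) unfolding K_def by auto
  have "map_poly red q' \<noteq> 0"
  proof
    assume "map_poly red q' = 0"
    then obtain u where "q' = [:2:] * u" by (auto simp: map_poly_red_eq_0_iff elim: dvdE)
    hence "q = smult (2 ^ Suc k) u" using q'(1) by (simp add: mult.commute)
    hence "Suc k \<in> K" unfolding K_def by auto
    thus False using k(2) by simp
  qed
  thus ?thesis using q' bound[OF k(1)] by blast
qed

text \<open>
  Separability of \<open>P = x^p - 1\<close> in explicit form: \<open>x P' - p P = p\<close>, and \<open>p = 1\<close> in characteristic 2.
  Expanding \<open>P' = g' h + g h'\<close> gives the Bezout relation \<open>(x h' - h) g + x g' h = 1\<close> for the reductions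
  (primes denoting derivatives). Its coefficients lie in \<open>{0, 1}\<close> and so lift to \<open>'r\<close>.
\<close>

lemma xp1_bezout:
  fixes g h :: "'r poly"
  assumes "odd p" and "[:2:] dvd xp1 p - g * h"
  shows "\<exists>a b. [:2:] dvd a * g + b * h - 1"
proof -
  define g' h' where "g' = map_poly red g" and "h' = map_poly red h"
  have fact: "xp1 p = g' * h'"
  proof -
    have "map_poly red (xp1 p) = map_poly red (g * h)"
      using assms(2) by (simp add: map_poly_red_eq_iff)
    thus ?thesis by (simp add: g'_def h'_def red_poly.hom_mult xp1_def red_poly.hom_minus)
  qed
  have bin: "coeff (pderiv (map_poly red f)) n \<in> {0, 1}" for f n
  proof -
    have "coeff (pderiv (map_poly red f)) n = red (of_nat (Suc n) * coeff f (Suc n))"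
      by (simp add: coeff_pderiv hom_mult hom_add hom_of_nat)
    thus ?thesis using red_binary by metis
  qed
  obtain j where j: "p = 2 * j + 1" using assms(1) by (auto elim: oddE)
  have p1: "of_nat p = (1::'f poly)"
    unfolding j using char_two by (simp add: numeral_poly)
  define X where "X = monom (1::'f) 1"
  define a where "a = monom 1 1 * map_poly lift_bit (pderiv h') - h"
  define b where "b = monom 1 1 * map_poly lift_bit (pderiv g')"
  have ab: "map_poly red a = X * pderiv h' - h'" "map_poly red b = X * pderiv g'"
    using map_poly_red_lift[OF bin]
    by (simp_all add: a_def b_def X_def g'_def h'_def red_poly.hom_mult red_poly.hom_minus)
  have "map_poly red (a * g + b * h - 1) = map_poly red a * g' + map_poly red b * h' - 1"
    by (simp add: red_poly.hom_mult red_poly.hom_minus red_poly.hom_add g'_def h'_def)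
  also have "\<dots> = X * pderiv (g' * h') - g' * h' - 1"
    unfolding ab by (simp add: pderiv_mult algebra_simps)
  also have "\<dots> = X * pderiv (xp1 p) - of_nat p * xp1 p - of_nat p"
    unfolding fact p1 by simp
  also have "\<dots> = 0"
    unfolding xp1_def X_def
    by (simp add: pderiv_diff pderiv_monom mult_monom of_nat_monom algebra_simps smult_monom j)
  finally show ?thesis unfolding map_poly_red_eq_0_iff by blast
qed

lemma xp1_hensel_ex1:
  fixes g h :: "'r poly"
  assumes "odd p" and "lead_coeff g = 1" and fact: "[:2:] dvd xp1 p - g * h"
  shows "\<exists>!G. lead_coeff G = 1 \<and> G dvd xp1 p \<and> [:2:] dvd G - g"
proof -
  obtain a b where "[:2:] dvd a * g + b * h - 1" using xp1_bezout[OF assms(1) fact] by blast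
  from hensel_factor_exists[OF two_power_m assms(2) fact this]
  obtain G where "lead_coeff G = 1 \<and> G dvd xp1 p \<and> [:2:] dvd G - g" by blast
  moreover have "G\<^sub>1 = G\<^sub>2" if 1: "lead_coeff G\<^sub>1 = 1 \<and> G\<^sub>1 dvd xp1 p \<and> [:2:] dvd G\<^sub>1 - g"
    and 2: "lead_coeff G\<^sub>2 = 1 \<and> G\<^sub>2 dvd xp1 p \<and> [:2:] dvd G\<^sub>2 - g" for G\<^sub>1 G\<^sub>2
  proof -
    obtain H\<^sub>1 H\<^sub>2 where H: "xp1 p = G\<^sub>1 * H\<^sub>1" "xp1 p = G\<^sub>2 * H\<^sub>2" using 1 2 by (auto elim!: dvdE)
    have cong: "[:2:] dvd G\<^sub>1 - G\<^sub>2"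
      using dvd_diff[of "[:2:]" "G\<^sub>1 - g" "G\<^sub>2 - g"] 1 2 by simp
    have "xp1 p - G\<^sub>1 * H\<^sub>2 = - (G\<^sub>1 - G\<^sub>2) * H\<^sub>2" unfolding H(2) by (simp add: algebra_simps)
    hence "[:2:] dvd xp1 p - G\<^sub>1 * H\<^sub>2" using cong by (metis dvd_minus_iff dvd_mult2)
    from xp1_bezout[OF assms(1) this]
    obtain a b where "[:2:] dvd a * G\<^sub>1 + b * H\<^sub>2 - 1" by blast
    thus ?thesis using hensel_factor_unique[OF two_power_m _ _ cong, of H\<^sub>1 H\<^sub>2] 1 2 H by metis
  qed
  ultimately show ?thesis by blast
qed

lemma root_poly_hensel_ex1:
  fixes \<xi> :: 'f
  assumes "prime p" "odd p" "\<xi> ^ p = 1" "\<xi> \<noteq> 1" and I: "I \<subseteq> {..<p}"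
    and dbl: "\<And>i. i \<in> I \<Longrightarrow> 2 * i mod p \<in> I"
  shows "\<exists>!G. lead_coeff G = 1 \<and> G dvd xp1 p \<and> map_poly red G = root_poly \<xi> I"
proof -
  define g where "g = map_poly lift_bit (root_poly \<xi> I)"
  define h where "h = map_poly lift_bit (root_poly \<xi> ({..<p} - I))"
  have g: "map_poly red g = root_poly \<xi> I"
    unfolding g_def
    by (intro map_poly_red_lift root_poly_coeffs_binary[OF char_two assms(2,3) I dbl])
  have h: "map_poly red h = root_poly \<xi> ({..<p} - I)"
    unfolding h_def
    by (intro map_poly_red_lift
        root_poly_coeffs_binary[OF char_two assms(2,3) _ complement_doubling[OF assms(2) I dbl]]) auto
  have "lead_coeff g = 1"
  proof -
    have "degree g = degree (root_poly \<xi> I)" unfolding g_def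
      by (intro degree_map_poly) (simp_all add: lift_bit_def)
    thus ?thesis
      using monic_root_poly[of \<xi> I] by (simp add: g_def coeff_map_poly lift_bit_def)
  qed
  moreover have "map_poly red (xp1 p) = map_poly red (g * h)"
    using xp1_eq_root_poly[OF assms(1,3,4)] root_poly_mult_complement[of "{..<p}" I \<xi>] I
    by (simp add: red_poly.hom_mult g h xp1_def red_poly.hom_minus)
  hence "[:2:] dvd xp1 p - g * h" by (simp only: map_poly_red_eq_iff)
  ultimately show ?thesis
    using xp1_hensel_ex1[OF assms(2)] map_poly_red_eq_iff[of _ g] unfolding g by simp
qed

end

section \<open>Lighter codewords from even-like ones\<close>

text \<open>
  The generator divides \<open>x^p - 1\<close>, so the code has a description without reduction modulo
  \<open>x^p - 1\<close>.
\<close>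

lemma cyclic_code_iff_dvd:
  assumes "g dvd xp1 p"
  shows "c \<in> cyclic_code p g \<longleftrightarrow> degree c < p \<and> g dvd c"
proof -
  have "g dvd c" if "xp1 p dvd c - h * g" for h
  proof -
    have "g dvd (c - h * g) + h * g" using that assms by (metis dvd_add dvd_trans dvd_triv_right)
    thus ?thesis by simp
  qed
  moreover have "\<exists>h. xp1 p dvd c - h * g" if "g dvd c"
  proof -
    from that obtain h where "c = g * h" by (elim dvdE)
    thus ?thesis by (intro exI[of _ h]) (simp add: mult.commute)
  qed
  ultimately show ?thesis unfolding cyclic_code_def by blast
qed

lemma poly_eq_sum_lessThan:
  fixes f :: "'a::comm_semiring_1 poly"
  assumes "degree f < p"
  shows "poly f x = (\<Sum>j<p. coeff f j * x ^ j)"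
  unfolding poly_altdef
  by (rule sum.mono_neutral_left) (use assms in \<open>auto simp: coeff_eq_0 not_le\<close>)

context binary_reduction
begin

text \<open>
  The even-like codeword is \<open>2 ^ k\<close> times a multiple \<open>u\<close> of \<open>g\<close> with nonzero reduction \<open>b\<close>. Then \<open>b\<close>
  is a binary codeword supported inside the support of \<open>c\<close>, and its coordinate sum is 0 because
  \<open>2 ^ k\<close> kills no unit. Moving a nonzero coordinate of \<open>b\<close> to infinity
  gives a binary codeword of weight one less, and \<open>2 ^ (m - 1)\<close> times any lift of it is a
  codeword over \<open>'r\<close> of that same weight.
\<close>

lemma even_like_has_lighter_codeword:
  fixes \<xi> :: 'f and g :: "'r poly"
  assumes "prime p" "odd p" "\<xi> ^ p = 1" "\<xi> \<noteq> 1" and I: "I \<subseteq> {1..<p}"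
    and nonres: "\<And>i k z. i \<in> I \<Longrightarrow> k \<in> {1..<p} - I \<Longrightarrow> \<not> [i * z ^ 2 = k] (mod p)"
    and monic: "lead_coeff g = 1" and dvd: "g dvd xp1 p"
    and g: "map_poly red g = root_poly \<xi> I"
    and c: "c \<in> cyclic_code p g" "c \<noteq> 0" and even: "even_like p c"
  shows "\<exists>d\<in>cyclic_code p g. d \<noteq> 0 \<and> hamming_weight p d < hamming_weight p c"
proof -
  have fin: "finite I" using I finite_subset by blast
  have deg_g: "degree g = card I"
  proof -
    have "degree (map_poly red g) = degree g"
      using monic by (intro antisym degree_map_poly_le le_degree) simp
    thus ?thesis unfolding g degree_root_poly[OF fin] ..
  qed
  have "g dvd c" using c(1) cyclic_code_iff_dvd[OF dvd] by blast
  then obtain q where q: "c = q * g" by (metis dvdE mult.commute)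
  hence "q \<noteq> 0" using c(2) by auto
  then obtain k q' where k: "k < m" "q = smult (2 ^ k) q'" "map_poly red q' \<noteq> 0"
      "degree q' \<le> degree q"
    using ex_two_power_factor by blast
  define u where "u = q' * g"
  define b where "b = map_poly red u"
  have c_u: "c = smult (2 ^ k) u" using q k(2) by (simp add: u_def)
  have deg_b: "degree b < p"
  proof -
    have "degree b \<le> degree u" unfolding b_def by (rule degree_map_poly_le)
    also have "\<dots> \<le> degree q + degree g"
      unfolding u_def using degree_mult_le[of q' g] k(4) by simp
    also have "\<dots> = degree c"
      unfolding q using degree_monic_mult[OF monic \<open>q \<noteq> 0\<close>] by (simp add: mult.commute)
    also have "\<dots> < p" using c(1) cyclic_code_iff_dvd[OF dvd] by blast
    finally show ?thesis .
  qed
  have b_eq: "b = map_poly red q' * root_poly \<xi> I"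
    by (simp add: b_def u_def red_poly.hom_mult g)
  have "b \<noteq> 0" using b_eq k(3) monic_root_poly[of \<xi> I] by auto
  define j\<^sub>0 where "j\<^sub>0 = degree b"
  have j\<^sub>0: "j\<^sub>0 < p" "coeff b j\<^sub>0 \<noteq> 0" using deg_b \<open>b \<noteq> 0\<close> by (simp_all add: j\<^sub>0_def)
  have b_sum: "(\<Sum>j<p. coeff b j) = 0"
  proof -
    have "2 ^ k * (\<Sum>j<p. coeff u j) = 0"
      using even unfolding even_like_def c_u by (simp add: sum_distrib_left)
    hence "red (\<Sum>j<p. coeff u j) = 0" using two_power_mult_nonzero[OF k(1)] by blast
    thus ?thesis by (simp add: b_def hom_sum)
  qed
  have b_zeros: "(\<Sum>j<p. coeff b j * \<xi> ^ (i * j)) = 0" if "i \<in> I" for i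
  proof -
    have "poly b (\<xi> ^ i) = 0"
      using that poly_root_poly_eq_0_iff[OF fin] unfolding b_eq by auto
    thus ?thesis unfolding poly_eq_sum_lessThan[OF deg_b] by (simp add: power_mult)
  qed
  obtain \<pi> where bij: "bij_betw \<pi> {1..<p} ({..<p} - {j\<^sub>0})"
    and zeros: "\<And>i. i \<in> I \<Longrightarrow> (\<Sum>y\<in>{1..<p}. coeff b (\<pi> y) * \<xi> ^ (i * y)) = 0"
    using gleason_prange_shortening[OF char_two assms(1-4) I nonres b_sum b_zeros j\<^sub>0(1)] by metis
  define s where "s = (\<Sum>y\<in>{1..<p}. monom (lift_bit (coeff b (\<pi> y))) y)"
  have coeff_s: "coeff s n = (if n \<in> {1..<p} then lift_bit (coeff b (\<pi> n)) else 0)" for n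
    unfolding s_def by (simp add: coeff_sum)
  have deg_s: "degree s < p"
    using j\<^sub>0(1) by (intro degree_lessI) (auto simp: coeff_s)
  have red_s: "coeff (map_poly red s) n = (if n \<in> {1..<p} then coeff b (\<pi> n) else 0)" for n
  proof -
    have "coeff b (\<pi> n) \<in> {0, 1}" using red_binary by (simp add: b_def)
    thus ?thesis using red_lift_bit by (simp add: coeff_s)
  qed
  have s_zeros: "poly (map_poly red s) (\<xi> ^ i) = 0" if i: "i \<in> I" for i
  proof -
    have "poly (map_poly red s) (\<xi> ^ i) = (\<Sum>j<p. coeff (map_poly red s) j * (\<xi> ^ i) ^ j)"
      using deg_s degree_map_poly_le[of red s] by (intro poly_eq_sum_lessThan) simp
    also have "\<dots> = (\<Sum>y\<in>{1..<p}. coeff b (\<pi> y) * \<xi> ^ (i * y))"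
      unfolding red_s by (rule sum.mono_neutral_cong_right) (auto simp: power_mult)
    finally show ?thesis using zeros[OF i] by simp
  qed
  \<comment> \<open>the lift \<open>s\<close> need not be a multiple of \<open>g\<close>, but its remainder is divisible by 2\<close>
  obtain q\<^sub>2 r where r: "s = q\<^sub>2 * g + r" "r = 0 \<or> degree r < degree g"
    using monic_division[OF monic] by blast
  have "map_poly red r = 0"
  proof (cases "r = 0")
    case False
    have "map_poly red s = map_poly red q\<^sub>2 * root_poly \<xi> I + map_poly red r"
      unfolding r(1) by (simp add: red_poly.hom_mult red_poly.hom_add g)
    hence "poly (map_poly red r) (\<xi> ^ i) = 0" if "i \<in> I" for i
      using s_zeros[OF that] poly_root_poly_eq_0_iff[OF fin, of \<xi> "\<xi> ^ i"] that by auto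
    moreover have "degree (map_poly red r) < card I"
      using False r(2) degree_map_poly_le[of red r] deg_g by simp
    ultimately show ?thesis
      using I by (intro poly_eq_0_if_vanishes_on_powers[OF assms(1,3,4), of I]) auto
  qed simp
  then obtain r' where r': "r = [:2:] * r'" unfolding map_poly_red_eq_0_iff by (elim dvdE)
  define d where "d = smult (2 ^ (m - 1)) s"
  have "m > 0" using k(1) by simp
  have "d = smult (2 ^ (m - 1)) (q\<^sub>2 * g) + smult (2 ^ (m - 1) * 2) r'"
    unfolding d_def r(1) r' by (simp add: smult_add_right)
  also have "(2::'r) ^ (m - 1) * 2 = 0"
    using two_power_m \<open>m > 0\<close> by (metis power_minus_mult)
  finally have "d = smult (2 ^ (m - 1)) q\<^sub>2 * g" by simp
  hence "g dvd d" by (metis dvd_triv_right)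
  moreover have "degree d < p" using deg_s le_less_trans[OF degree_smult_le] unfolding d_def by blast
  ultimately have "d \<in> cyclic_code p g" using cyclic_code_iff_dvd[OF dvd] by blast
  have coeff_d: "coeff d n \<noteq> 0 \<longleftrightarrow> n \<in> {1..<p} \<and> coeff b (\<pi> n) \<noteq> 0" for n
    using two_power_nonzero[of "m - 1"] \<open>m > 0\<close> by (auto simp: d_def coeff_s lift_bit_def)
  have "d \<noteq> 0"
  proof
    assume "d = 0"
    hence "coeff b (\<pi> y) = 0" if "y \<in> {1..<p}" for y using coeff_d[of y] that by simp
    hence zero: "coeff b j = 0" if "j \<in> {..<p} - {j\<^sub>0}" for j
      using bij that unfolding bij_betw_def by (metis imageE)
    have "(\<Sum>j<p. coeff b j) = coeff b j\<^sub>0 + (\<Sum>j\<in>{..<p} - {j\<^sub>0}. coeff b j)"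
      using j\<^sub>0(1) by (intro sum.remove) auto
    also have "(\<Sum>j\<in>{..<p} - {j\<^sub>0}. coeff b j) = 0" using zero by (intro sum.neutral) blast
    finally show False using b_sum j\<^sub>0(2) by simp
  qed
  have "hamming_weight p d < hamming_weight p c"
  proof -
    define S where "S = {j. j < p \<and> coeff b j \<noteq> 0}"
    have "{y. y < p \<and> coeff d y \<noteq> 0} = {y \<in> {1..<p}. coeff b (\<pi> y) \<noteq> 0}"
      unfolding coeff_d by auto
    moreover have "bij_betw \<pi> {y \<in> {1..<p}. coeff b (\<pi> y) \<noteq> 0} (S - {j\<^sub>0})"
    proof -
      have "\<pi> ` {y \<in> {1..<p}. coeff b (\<pi> y) \<noteq> 0} = {j \<in> \<pi> ` {1..<p}. coeff b j \<noteq> 0}" by blast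
      also have "\<dots> = S - {j\<^sub>0}" unfolding bij_betw_imp_surj_on[OF bij] S_def by blast
      finally show ?thesis
        using inj_on_subset[OF bij_betw_imp_inj_on[OF bij]] by (simp add: bij_betw_def subset_eq)
    qed
    ultimately have "hamming_weight p d = card (S - {j\<^sub>0})"
      unfolding hamming_weight_def by (simp add: bij_betw_same_card)
    also have "\<dots> < card S" using j\<^sub>0 unfolding S_def by (intro psubset_card_mono) auto
    also have "card S \<le> hamming_weight p c"
      unfolding hamming_weight_def S_def c_u
      using two_power_mult_nonzero[OF k(1)] by (intro card_mono) (auto simp: b_def)
    finally show ?thesis .
  qed
  thus ?thesis using \<open>d \<in> cyclic_code p g\<close> \<open>d \<noteq> 0\<close> by blast
qed

end

section \<open>Minimum weight codewords over the integers modulo a power of 2\<close>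

lemma of_int_eq_parity_char2:
  assumes "CHAR('f::field) = 2"
  shows "(of_int a :: 'f) = (if even a then 0 else 1)"
proof -
  have two: "(2::'f) = 0" using of_nat_CHAR[where 'a = 'f] assms by simp
  show ?thesis using two by (auto elim!: evenE oddE)
qed

lemma binary_reduction_reduce2:
  assumes "m > 0" and card: "CARD('n::nontriv) = 2 ^ m" and char: "CHAR('f::field) = 2"
  shows "binary_reduction (reduce2 :: 'n mod_ring \<Rightarrow> 'f) m"
proof -
  note parity = of_int_eq_parity_char2[OF char]
  have even: "even (CARD('n))" using assms by simp
  have mod: "even (z mod int CARD('n)) \<longleftrightarrow> even z" for z
    using even by (metis dvd_mod_iff even_of_nat)
  have two_pow: "(2::'n mod_ring) ^ k = of_nat (2 ^ k)" for k by simp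
  have "(of_nat k :: 'n mod_ring) = 0 \<longleftrightarrow> CARD('n) dvd k" for k
    using of_nat_eq_0_iff_char_dvd[where 'a = "'n mod_ring", of k] by simp
  note nat0 = this
  show ?thesis
  proof
    fix x y :: "'n mod_ring"
    show "(reduce2 (x + y) :: 'f) = reduce2 x + reduce2 y"
      unfolding reduce2_def to_int_mod_ring_add of_int_add[symmetric] unfolding parity mod ..
    show "(reduce2 (x * y) :: 'f) = reduce2 x * reduce2 y"
      unfolding reduce2_def to_int_mod_ring_mult of_int_mult[symmetric] unfolding parity mod ..
    show "(reduce2 x :: 'f) \<in> {0, 1}" unfolding reduce2_def parity by simp
    show "(reduce2 x :: 'f) = 0 \<longleftrightarrow> 2 dvd x"
    proof
      assume "(reduce2 x :: 'f) = 0"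
      hence "even (to_int_mod_ring x)" unfolding reduce2_def parity by (simp split: if_splits)
      then obtain z where "to_int_mod_ring x = 2 * z" by (elim evenE)
      hence "of_int_mod_ring (to_int_mod_ring x) = (of_int (2 * z) :: 'n mod_ring)"
        by (simp only: of_int_of_int_mod_ring)
      thus "2 dvd x" by simp
    next
      assume "2 dvd x"
      then obtain z where "x = z + z" by (metis dvdE mult_2)
      thus "(reduce2 x :: 'f) = 0"
        unfolding reduce2_def by (simp only: to_int_mod_ring_add parity mod) simp
    qed
  next
    show "(2::'n mod_ring) ^ m = 0" unfolding two_pow nat0 card by simp
    show "(2::'n mod_ring) ^ k \<noteq> 0" if "k < m" for k
      unfolding two_pow nat0 card using that power_dvd_imp_le[of 2 m k] by auto
  qed (simp_all add: reduce2_def)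
qed

theorem theoremV4:
  fixes m p :: nat
    and \<xi> :: "'f::field"
    and C :: "'n::nontriv mod_ring poly set"
  assumes "m \<ge> 2" and "CARD('n) = 2 ^ m"
    and "prime p" and "odd p" and "[int p = 1] (mod 8) \<or> [int p = - 1] (mod 8)"
    and "CHAR('f) = 2" and "primitive_root_of_unity p \<xi>"
    and "C = QR_code p \<xi> \<or> C = NR_code p \<xi>"
  shows "\<forall>c\<in>C. c \<noteq> 0 \<and> (\<forall>d\<in>C. d \<noteq> 0 \<longrightarrow> hamming_weight p c \<le> hamming_weight p d)
           \<longrightarrow> odd_like p c"
proof -
  interpret binary_reduction "reduce2 :: 'n mod_ring \<Rightarrow> 'f" m
    using assms(1,2,6) by (intro binary_reduction_reduce2) auto
  have p: "p > 2" using assms(3,4) prime_ge_2_nat[of p] by (cases "p = 2") auto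
  have \<xi>: "\<xi> ^ p = 1" "\<xi> \<noteq> 1"
    using assms(7) p unfolding primitive_root_of_unity_def by (auto dest: spec[of _ 1])
  have nd: "\<not> p dvd i" if "i \<in> {1..<p}" for i using that nat_dvd_not_less by auto
  obtain t where t: "[t ^ 2 = 2] (mod int p)"
    using QuadRes_two[OF assms(3,4,5)] unfolding QuadRes_def by blast
  define z where "z = nat (t mod int p)"
  have z: "[2 = z ^ 2] (mod p)"
  proof -
    have "[int z ^ 2 = t ^ 2] (mod int p)" using p unfolding z_def by (intro cong_pow) simp
    hence "[int (z ^ 2) = int 2] (mod int p)" using t by (simp add: cong_trans)
    thus ?thesis by (metis cong_int_iff cong_sym)
  qed
  \<comment> \<open>doubling preserves both index sets, so both binary generators have coefficients in \<open>{0, 1}\<close>\<close>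
  have double: "2 * i mod p \<in> {1..<p} \<and> (QuadRes (int p) (int i) \<longleftrightarrow> QuadRes (int p) (int (2 * i mod p)))"
    if i: "i \<in> {1..<p}" for i
  proof -
    have "\<not> p dvd 2" using p nat_dvd_not_less by auto
    hence "\<not> p dvd 2 * i" using nd[OF i] assms(3) by (simp add: prime_dvd_mult_iff)
    hence ndm: "\<not> p dvd 2 * i mod p" by (simp add: dvd_mod_iff)
    hence "2 * i mod p \<noteq> 0" by (metis dvd_0_right)
    hence "2 * i mod p \<in> {1..<p}" using p by simp
    moreover have "[i * z ^ 2 = 2 * i mod p] (mod p)"
    proof -
      have "[i * z ^ 2 = i * 2] (mod p)" using z by (intro cong_scalar_left) (rule cong_sym)
      thus ?thesis by (simp add: mult.commute)
    qed
    ultimately show ?thesis using QuadRes_mult_square_cong[OF assms(3) ndm] by blast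
  qed
  have main: "odd_like p c"
    if CI: "C = cyclic_code p (hensel_lift p (root_poly \<xi> I))" and IQ: "I = residues_nz p \<or> I = nonresidues p"
      and c: "c \<in> C" "c \<noteq> 0" "\<forall>d\<in>C. d \<noteq> 0 \<longrightarrow> hamming_weight p c \<le> hamming_weight p d" for I c
  proof
    assume even: "even_like p c"
    have I: "I \<subseteq> {1..<p}" using IQ unfolding residues_nz_def nonresidues_def by auto
    hence I': "I \<subseteq> {..<p}" by auto
    have dbl: "2 * i mod p \<in> I" if "i \<in> I" for i
      using that double[of i] IQ unfolding residues_nz_def nonresidues_def by auto
    have nonres: "\<not> [i * z ^ 2 = k] (mod p)" if "i \<in> I" "k \<in> {1..<p} - I" for i k z
      using that IQ QuadRes_mult_square_cong[OF assms(3) nd, of k i z]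
      unfolding residues_nz_def nonresidues_def by auto
    define g where "g = (hensel_lift p (root_poly \<xi> I) :: 'n mod_ring poly)"
    have g: "lead_coeff g = 1 \<and> g dvd xp1 p \<and> map_poly reduce2 g = root_poly \<xi> I"
      unfolding g_def hensel_lift_def
      by (rule theI', rule root_poly_hensel_ex1[OF assms(3,4) \<xi> I' dbl])
    obtain d where "d \<in> C" "d \<noteq> 0" "hamming_weight p d < hamming_weight p c"
      using even_like_has_lighter_codeword[OF assms(3,4) \<xi> I nonres, of g c] g c even
      unfolding CI g_def[symmetric] by blast
    thus False using c(3) by fastforce
  qed
  from assms(8) show ?thesis
  proof
    assume "C = QR_code p \<xi>"
    thus ?thesis using main[of "residues_nz p"] unfolding QR_code_def by blast
  next
    assume "C = NR_code p \<xi>"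
    thus ?thesis using main[of "nonresidues p"] unfolding NR_code_def by blast
  qed
qed

end
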